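(* Let $m,n\ge 1$ be integers with $m\le n$ and $mn\geq 2$, and let $G=P_m\times P_n$ be the 2-dimensional grid. Then $mc^{nh}_{mn}(G)\geq\left\lfloor\frac{mn-m}{2}\right\rfloor$.
   Context: All graphs are simple and finite. The 2-dimensional grid $P_m\times P_n$ is the Cartesian product of the path on $m$ vertices and the path on $n$ vertices: its vertices are the cells of an $m$ by $n$ array (so $mn$ vertices), with two cells adjacent iff they are horizontally or vertically neighbouring. For a graph $G$ with $N$ vertices, a no-hole anti-$N$-labeling of $G$ is a map $\psi:V(G)\to\{1,2,\ldots,N\}$ that uses all labels between $1$ and $N$ (hence a bijection). For an edge $e=uv$ put $w^{nh}_\psi(e)=|\psi(u)-\psi(v)|$, and let $w^{nh}_\psi(G)=\min\{w^{nh}_\psi(e): e\in E(G)\}$. The no-hole anti-$N$-labeling number of $G$ is $mc^{nh}_N(G)=\max_\psi w^{nh}_\psi(G)$, the maximum being over all no-hole anti-$N$-labelings $\psi$ of $G$. *)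

theory Defs
  imports Complex_Main
begin

type_synonym 'a ugraph = "'a set \<times> 'a set set"

abbreviation verts :: "'a ugraph \<Rightarrow> 'a set" where
  "verts G \<equiv> fst G"

abbreviation edges :: "'a ugraph \<Rightarrow> 'a set set" where
  "edges G \<equiv> snd G"

definition simple_graph :: "'a ugraph \<Rightarrow> bool" where
  "simple_graph G \<longleftrightarrow> finite (verts G) \<and> (\<forall>e\<in>edges G. e \<subseteq> verts G \<and> card e = 2)"

definition path_graph :: "nat \<Rightarrow> nat ugraph" where
  "path_graph n = ({1..n}, {{i, i + 1} | i. 1 \<le> i \<and> i < n})"

definition cartesian_product :: "'a ugraph \<Rightarrow> 'b ugraph \<Rightarrow> ('a \<times> 'b) ugraph" where
  "cartesian_product G H =
     (verts G \<times> verts H,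
      {{(u, x), (u, y)} | u x y. u \<in> verts G \<and> {x, y} \<in> edges H} \<union>
      {{(u, x), (v, x)} | u v x. {u, v} \<in> edges G \<and> x \<in> verts H})"

definition grid_graph :: "nat \<Rightarrow> nat \<Rightarrow> (nat \<times> nat) ugraph" where
  "grid_graph m n = cartesian_product (path_graph m) (path_graph n)"

text \<open>
  The notions below are meant for \<open>N = card (verts G)\<close>, in which case a no-hole anti-labeling is
  a bijection onto \<open>{1..N}\<close> (lemma \<open>no_hole_anti_labeling_bij\<close>).
\<close>

definition no_hole_anti_labeling :: "nat \<Rightarrow> 'a ugraph \<Rightarrow> ('a \<Rightarrow> nat) \<Rightarrow> bool" where
  "no_hole_anti_labeling N G \<psi> \<longleftrightarrow> \<psi> ` verts G = {1..N}"

definition edge_weight :: "('a \<Rightarrow> nat) \<Rightarrow> 'a \<Rightarrow> 'a \<Rightarrow> nat" where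
  "edge_weight \<psi> u v = nat \<bar>int (\<psi> u) - int (\<psi> v)\<bar>"

definition labeling_weight :: "'a ugraph \<Rightarrow> ('a \<Rightarrow> nat) \<Rightarrow> nat" where
  "labeling_weight G \<psi> = Min {edge_weight \<psi> u v | u v. {u, v} \<in> edges G}"

definition mc_nh :: "nat \<Rightarrow> 'a ugraph \<Rightarrow> nat" where
  "mc_nh N G = Max {labeling_weight G \<psi> | \<psi>. no_hole_anti_labeling N G \<psi>}"

lemma no_hole_anti_labeling_bij:
  assumes "finite (verts G)"
  shows "no_hole_anti_labeling (card (verts G)) G \<psi> \<longleftrightarrow> bij_betw \<psi> (verts G) {1..card (verts G)}"
  using assms unfolding no_hole_anti_labeling_def bij_betw_def
  by (auto intro: eq_card_imp_inj_on)

lemma card_verts_grid_graph: "card (verts (grid_graph m n)) = m * n"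
  by (simp add: grid_graph_def cartesian_product_def path_graph_def)

lemma edges_path_graph_iff:
  "{x, y} \<in> edges (path_graph n) \<longleftrightarrow> x \<in> {1..n} \<and> y \<in> {1..n} \<and> (y = x + 1 \<or> x = y + 1)"
  by (auto simp: path_graph_def doubleton_eq_iff)

lemma edges_cartesian_product_iff:
  "{(u, x), (v, y)} \<in> edges (cartesian_product G H) \<longleftrightarrow>
     u = v \<and> u \<in> verts G \<and> {x, y} \<in> edges H \<or> x = y \<and> x \<in> verts H \<and> {u, v} \<in> edges G"
  (is "?e \<in> _ \<longleftrightarrow> ?R")
proof
  assume "?e \<in> edges (cartesian_product G H)"
  then have "(\<exists>w a b. ?e = {(w, a), (w, b)} \<and> w \<in> verts G \<and> {a, b} \<in> edges H) \<or>
      (\<exists>c d z. ?e = {(c, z), (d, z)} \<and> {c, d} \<in> edges G \<and> z \<in> verts H)"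
    unfolding cartesian_product_def snd_conv Un_iff mem_Collect_eq .
  then consider
    (H) w a b where "?e = {(w, a), (w, b)}" "w \<in> verts G" "{a, b} \<in> edges H"
  | (G) c d z where "?e = {(c, z), (d, z)}" "{c, d} \<in> edges G" "z \<in> verts H"
    by (elim disjE exE conjE)
  then show ?R
  proof cases
    case H
    then have "u = w \<and> v = w \<and> {x, y} = {a, b}"
      unfolding doubleton_eq_iff prod.inject by blast
    with H show ?thesis by simp
  next
    case G
    then have "x = z \<and> y = z \<and> {u, v} = {c, d}"
      unfolding doubleton_eq_iff prod.inject by blast
    with G show ?thesis by simp
  qed
next
  assume ?R
  then show "?e \<in> edges (cartesian_product G H)"
    unfolding cartesian_product_def snd_conv by blast
qed

lemma edges_grid_graph_iff:
  "{(i, j), (k, l)} \<in> edges (grid_graph m n) \<longleftrightarrow>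
     i \<in> {1..m} \<and> k \<in> {1..m} \<and> j \<in> {1..n} \<and> l \<in> {1..n} \<and>
     (i = k \<and> (l = j + 1 \<or> j = l + 1) \<or> j = l \<and> (k = i + 1 \<or> i = k + 1))"
  unfolding grid_graph_def edges_cartesian_product_iff edges_path_graph_iff
  by (auto simp: path_graph_def)

lemma simple_graph_grid_graph: "simple_graph (grid_graph m n)"
  by (auto simp: simple_graph_def grid_graph_def cartesian_product_def path_graph_def
      doubleton_eq_iff card_insert_if)

text \<open>The minimum and the maximum above are taken over finite nonempty sets.\<close>

lemma edge_weights_finite_nonempty:
  assumes "simple_graph G" "edges G \<noteq> {}"
  shows "finite {edge_weight \<psi> u v | u v. {u, v} \<in> edges G}"
    and "{edge_weight \<psi> u v | u v. {u, v} \<in> edges G} \<noteq> {}"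
proof -
  have "{edge_weight \<psi> u v | u v. {u, v} \<in> edges G}
      \<subseteq> (\<lambda>(u, v). edge_weight \<psi> u v) ` (verts G \<times> verts G)"
    using assms(1) by (fastforce simp: simple_graph_def)
  moreover have "finite (verts G)"
    using assms(1) by (simp add: simple_graph_def)
  ultimately show "finite {edge_weight \<psi> u v | u v. {u, v} \<in> edges G}"
    by (meson finite_SigmaI finite_imageI finite_subset)
  from assms(2) obtain e where e: "e \<in> edges G" by blast
  with assms(1) have "card e = 2" by (simp add: simple_graph_def)
  with e show "{edge_weight \<psi> u v | u v. {u, v} \<in> edges G} \<noteq> {}"
    by (auto simp: card_2_iff)
qed

lemma labeling_weights_finite_nonempty:
  assumes G: "simple_graph G" "edges G \<noteq> {}" and N: "N = card (verts G)"
  shows "finite {labeling_weight G \<psi> | \<psi>. no_hole_anti_labeling N G \<psi>}"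
    and "{labeling_weight G \<psi> | \<psi>. no_hole_anti_labeling N G \<psi>} \<noteq> {}"
proof -
  have "labeling_weight G \<psi> \<le> N" if \<psi>: "no_hole_anti_labeling N G \<psi>" for \<psi>
  proof -
    have "labeling_weight G \<psi> \<in> {edge_weight \<psi> u v | u v. {u, v} \<in> edges G}"
      unfolding labeling_weight_def by (rule Min_in) (rule edge_weights_finite_nonempty[OF G])+
    then obtain u v where uv: "labeling_weight G \<psi> = edge_weight \<psi> u v" "{u, v} \<in> edges G"
      by blast
    then have "u \<in> verts G" "v \<in> verts G"
      using G(1) by (auto simp: simple_graph_def)
    then have "\<psi> u \<in> {1..N}" "\<psi> v \<in> {1..N}"
      using \<psi> by (auto simp: no_hole_anti_labeling_def)
    then show ?thesis
      unfolding uv(1) edge_weight_def atLeastAtMost_iff by linarith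
  qed
  then have "{labeling_weight G \<psi> | \<psi>. no_hole_anti_labeling N G \<psi>} \<subseteq> {..N}"
    by auto
  then show "finite {labeling_weight G \<psi> | \<psi>. no_hole_anti_labeling N G \<psi>}"
    by (rule finite_subset) simp
  have fin: "finite (verts G)"
    using G(1) by (simp add: simple_graph_def)
  have "\<exists>\<psi>. bij_betw \<psi> (verts G) {1..N}"
    by (rule finite_same_card_bij[OF fin]) (simp_all add: N)
  then obtain \<psi> where "no_hole_anti_labeling N G \<psi>"
    unfolding no_hole_anti_labeling_def bij_betw_def by blast
  then show "{labeling_weight G \<psi> | \<psi>. no_hole_anti_labeling N G \<psi>} \<noteq> {}"
    by blast
qed

end

theory Submission
  imports Defs
begin

text \<open>
  The grid is bipartite: colour a cell \<open>(i, j)\<close> by the parity of \<open>i + j\<close>. Give the even cells the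
  low labels and the odd cells the high labels, numbering the cells within either colour column by
  column. Two adjacent cells have different colours, so their labels differ by the offset
  \<open>\<lceil>mn/2\<rceil>\<close> between the two blocks, up to the difference of their ranks within the blocks.

  The rank is easy to control: in the column-by-column enumeration of all cells, with positions
  \<open>0, 1, \<dots>\<close>, the positions \<open>2k\<close> and \<open>2k + 1\<close> always carry cells of opposite colours, hence the
  cell at position \<open>p\<close> has rank \<open>p div 2\<close> in its own colour (lemma \<open>ex_cell_with_rank_and_colour\<close>;
  this is what makes the labeling use every label). Adjacent cells are at most \<open>m\<close> positions apart,
  so their ranks differ by at most \<open>\<lceil>m/2\<rceil>\<close>, and
  \<open>\<lceil>mn/2\<rceil> - \<lceil>m/2\<rceil> \<ge> \<lfloor>(mn - m)/2\<rfloor>\<close>.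
\<close>

definition cell_pos :: "nat \<Rightarrow> nat \<times> nat \<Rightarrow> nat" where
  "cell_pos m = (\<lambda>(i, j). (j - 1) * m + (i - 1))"

definition chequer_label :: "nat \<Rightarrow> nat \<Rightarrow> nat \<times> nat \<Rightarrow> nat" where
  "chequer_label m n = (\<lambda>(i, j).
     1 + cell_pos m (i, j) div 2 + (if odd (i + j) then (m * n + 1) div 2 else 0))"

lemma verts_grid_graph: "verts (grid_graph m n) = {1..m} \<times> {1..n}"
  by (simp add: grid_graph_def cartesian_product_def path_graph_def)

lemma ex_cell_at_pos:
  assumes "p < m * n"
  shows "(p mod m + 1, p div m + 1) \<in> verts (grid_graph m n)"
    and "cell_pos m (p mod m + 1, p div m + 1) = p"
proof -
  have "m > 0" using assms by (cases m) auto
  moreover have "p div m < n"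
    using assms by (simp add: less_mult_imp_div_less mult.commute)
  ultimately show "(p mod m + 1, p div m + 1) \<in> verts (grid_graph m n)"
    by (simp add: verts_grid_graph Suc_le_eq)
  show "cell_pos m (p mod m + 1, p div m + 1) = p"
    by (simp add: cell_pos_def)
qed

lemma colour_at_pos_odd_height:
  assumes "odd m"
  shows "odd (p mod m + p div m) \<longleftrightarrow> odd (p :: nat)"
proof -
  have "odd p \<longleftrightarrow> odd (p div m * m + p mod m)" by simp
  then show ?thesis using assms by (simp only: even_add even_mult_iff) blast
qed

text \<open>
  For odd \<open>m\<close> the colours alternate along the whole enumeration. For even \<open>m\<close> they alternate only
  within a column, but then a column has an even number of cells, so the positions \<open>2k\<close> and
  \<open>2k + 1\<close> never straddle two columns.
\<close>

lemma colours_of_pair_differ: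
  fixes k m :: nat
  shows "odd ((2 * k + 1) mod m + (2 * k + 1) div m) \<longleftrightarrow> even ((2 * k) mod m + (2 * k) div m)"
proof (cases "odd m")
  case True
  then show ?thesis
    using colour_at_pos_odd_height[of m "2 * k"] colour_at_pos_odd_height[of m "2 * k + 1"]
    by (metis dvd_triv_left even_plus_one_iff)
next
  case False
  then have "even ((2 * k) mod m)"
    by (simp add: dvd_mod_iff)
  then have "Suc ((2 * k) mod m) \<noteq> m" using False by (metis even_Suc)
  then have "Suc (2 * k) mod m = Suc ((2 * k) mod m)" "Suc (2 * k) div m = (2 * k) div m"
    by (simp_all add: mod_Suc div_Suc)
  then show ?thesis by simp
qed

text \<open>
  If \<open>m * n\<close> is odd, the last cell is left without a partner and is even; this is why the odd
  colour needs the stronger bound on the rank.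
\<close>

lemma ex_cell_with_rank_and_colour:
  assumes "2 * k < m * n" and "c \<Longrightarrow> 2 * k + 1 < m * n"
  shows "\<exists>(i, j) \<in> verts (grid_graph m n). cell_pos m (i, j) div 2 = k \<and> (odd (i + j) \<longleftrightarrow> c)"
proof -
  define col where "col p \<longleftrightarrow> odd (p mod m + p div m)" for p
  have "\<exists>p. p < m * n \<and> p div 2 = k \<and> (col p \<longleftrightarrow> c)"
  proof (cases "col (2 * k) \<longleftrightarrow> c")
    case True
    then show ?thesis using assms(1) by (intro exI[of _ "2 * k"]) simp
  next
    case False
    then have c: "col (2 * k + 1) \<longleftrightarrow> c"
      using colours_of_pair_differ[of k m] unfolding col_def by blast
    have "2 * k + 1 < m * n"
    proof (rule ccontr)
      assume neg: "\<not> 2 * k + 1 < m * n"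
      then have "m * n = 2 * k + 1" using assms(1) by simp
      then have "odd (m * n)" by simp
      then have "odd m" by simp
      then have "\<not> col (2 * k)"
        unfolding col_def using colour_at_pos_odd_height[of m "2 * k"] by simp
      then show False using False neg assms(2) by blast
    qed
    then show ?thesis using c by (intro exI[of _ "2 * k + 1"]) simp
  qed
  then obtain p where p: "p < m * n" "p div 2 = k" "col p \<longleftrightarrow> c" by blast
  show ?thesis
    using p ex_cell_at_pos[OF p(1)] unfolding col_def
    by (intro bexI[of _ "(p mod m + 1, p div m + 1)"]) simp_all
qed

text \<open>
  There are as many cells as labels, so it is enough that every label is attained.
\<close>

lemma no_hole_chequer_label:
  "no_hole_anti_labeling (m * n) (grid_graph m n) (chequer_label m n)"
proof -
  let ?V = "verts (grid_graph m n)" and ?C = "(m * n + 1) div 2"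
  have "L \<in> chequer_label m n ` ?V" if L: "L \<in> {1..m * n}" for L
  proof -
    define c where "c \<longleftrightarrow> ?C < L"
    define k where "k = (if c then L - 1 - ?C else L - 1)"
    have "2 * k < m * n" "c \<Longrightarrow> 2 * k + 1 < m * n"
      using L unfolding k_def c_def by (auto split: if_splits)
    then obtain i j where ij: "(i, j) \<in> ?V" "cell_pos m (i, j) div 2 = k" "odd (i + j) \<longleftrightarrow> c"
      using ex_cell_with_rank_and_colour[of k m n c] by blast
    have "chequer_label m n (i, j) = 1 + k + (if c then ?C else 0)"
      using ij(2,3) by (simp add: chequer_label_def)
    also have "\<dots> = L" using L unfolding k_def c_def by auto
    finally show ?thesis using ij(1) by force
  qed
  then have sub: "{1..m * n} \<subseteq> chequer_label m n ` ?V" by blast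
  have "finite ?V" by (simp add: verts_grid_graph)
  then have "card (chequer_label m n ` ?V) \<le> card {1..m * n}"
    using card_image_le card_verts_grid_graph by fastforce
  then show ?thesis
    unfolding no_hole_anti_labeling_def
    using card_seteq[OF _ sub] \<open>finite ?V\<close> by simp
qed

text \<open>
  The offset between the blocks already puts the odd cell above the even one, so only an odd cell
  that comes \<^emph>\<open>earlier\<close> in the enumeration can reduce the gap: a one-sided bound on the positions
  suffices.
\<close>

lemma chequer_label_gap:
  assumes "n > 0" and ab: "even (i + j)" "odd (k + l)"
    and pos: "cell_pos m (i, j) \<le> cell_pos m (k, l) + m"
  shows "chequer_label m n (i, j) + (m * n - m) div 2 \<le> chequer_label m n (k, l)"
proof -
  have "cell_pos m (i, j) div 2 \<le> cell_pos m (k, l) div 2 + (m + 1) div 2"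
    using pos by linarith
  moreover have "(m * n - m) div 2 + (m + 1) div 2 \<le> (m * n + 1) div 2"
  proof -
    have "m \<le> m * n" using \<open>n > 0\<close> by simp
    then show ?thesis by linarith
  qed
  ultimately show ?thesis
    using ab by (simp add: chequer_label_def)
qed

lemma adjacent_cells:
  assumes "{(i, j), (k, l)} \<in> edges (grid_graph m n)"
  shows "odd (i + j) \<longleftrightarrow> even (k + l)"
    and "cell_pos m (i, j) \<le> cell_pos m (k, l) + m"
proof -
  note e = assms[unfolded edges_grid_graph_iff]
  from e show "odd (i + j) \<longleftrightarrow> even (k + l)" by auto
  from e have "j - 1 \<le> l - 1 + 1" and "i = k \<or> j = l" "i - 1 \<le> k - 1 + 1" "m \<ge> 1" by auto
  then consider "i = k" "j - 1 \<le> l - 1 + 1" | "j = l" "i - 1 \<le> k - 1 + m" by linarith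
  then show "cell_pos m (i, j) \<le> cell_pos m (k, l) + m"
  proof cases
    case 1
    have "(j - 1) * m \<le> (l - 1 + 1) * m" using 1(2) by (rule mult_le_mono1)
    then show ?thesis using 1(1) by (simp add: cell_pos_def)
  next
    case 2
    then show ?thesis by (simp add: cell_pos_def)
  qed
qed

lemma edge_weight_chequer_label:
  assumes "{u, v} \<in> edges (grid_graph m n)"
  shows "(m * n - m) div 2 \<le> edge_weight (chequer_label m n) u v"
proof -
  obtain i j k l where uv: "u = (i, j)" "v = (k, l)" by (cases u, cases v)
  have e: "{(i, j), (k, l)} \<in> edges (grid_graph m n)"
    and e': "{(k, l), (i, j)} \<in> edges (grid_graph m n)"
    using assms by (simp_all add: uv insert_commute)
  have "n > 0" using e by (auto simp: edges_grid_graph_iff)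
  show ?thesis
  proof (cases "even (i + j)")
    case True
    then show ?thesis
      using chequer_label_gap[of n i j k l m] adjacent_cells[OF e] \<open>n > 0\<close>
      by (simp add: uv edge_weight_def)
  next
    case False
    then show ?thesis
      using chequer_label_gap[of n k l i j m] adjacent_cells[OF e] adjacent_cells(2)[OF e'] \<open>n > 0\<close>
      by (simp add: uv edge_weight_def)
  qed
qed

lemma grid_graph_has_edge:
  assumes "m * n \<ge> 2"
  shows "edges (grid_graph m n) \<noteq> {}"
proof -
  have "m \<ge> 1" "n \<ge> 1" using assms by (cases m; cases n; simp)+
  moreover have "m \<noteq> 1 \<or> n \<noteq> 1" using assms by auto
  ultimately have "m \<ge> 2 \<or> n \<ge> 2" by linarith
  then have "{(1, 1), (2, 1)} \<in> edges (grid_graph m n) \<or> {(1, 1), (1, 2)} \<in> edges (grid_graph m n)"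
    using \<open>m \<ge> 1\<close> \<open>n \<ge> 1\<close> unfolding edges_grid_graph_iff by auto
  then show ?thesis by blast
qed

theorem mainTheorem4:
  fixes m n :: nat
  assumes "m \<ge> 1" and "n \<ge> 1" and "m \<le> n" and "m * n \<ge> 2"
  shows "int (mc_nh (m * n) (grid_graph m n)) \<ge> \<lfloor>(real m * real n - real m) / 2\<rfloor>"
proof -
  let ?G = "grid_graph m n" and ?\<psi> = "chequer_label m n"
  note G = simple_graph_grid_graph[of m n] grid_graph_has_edge[OF assms(4)]
  have "(m * n - m) div 2 \<le> labeling_weight ?G ?\<psi>"
    unfolding labeling_weight_def
    using edge_weights_finite_nonempty[OF G, of ?\<psi>] edge_weight_chequer_label by auto
  also have "\<dots> \<le> mc_nh (m * n) ?G"
    unfolding mc_nh_def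
    using labeling_weights_finite_nonempty(1)[OF G card_verts_grid_graph[symmetric]]
      no_hole_chequer_label
    by (intro Max_ge) auto
  finally have le: "int ((m * n - m) div 2) \<le> int (mc_nh (m * n) ?G)" by simp
  have "real m * real n - real m = real (m * n - m)"
    using assms(2) by (simp add: of_nat_diff)
  then have "\<lfloor>(real m * real n - real m) / 2\<rfloor> = int ((m * n - m) div 2)"
    using floor_divide_of_nat_eq[of "m * n - m" 2, where ?'a = real] by simp
  then show ?thesis using le by simp
qed

end
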